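(* Let $R$ be a von Neumann regular (associative, unital) ring and let $a,b\in R$. Then $I(a)=I(b)$ if and only if $a=b$.
   Context: For an associative ring $R$ with unity and $a\in R$: an inner inverse of $a$ is an $x\in R$ with $axa=a$; $I(a)$ denotes the set of inner inverses of $a$. The ring $R$ is (von Neumann) regular if every element of $R$ has an inner inverse. *)

theory Defs
  imports "HOL-Algebra.Ring"
begin

definition inner_inverses :: "('a, 'm) ring_scheme \<Rightarrow> 'a \<Rightarrow> 'a set" where
  "inner_inverses R a = {x \<in> carrier R. a \<otimes>\<^bsub>R\<^esub> x \<otimes>\<^bsub>R\<^esub> a = a}"

text \<open>Rings in the sense of \<^locale>\<open>ring\<close> are associative and unital, not necessarily commutative;
  the zero ring is included.\<close>

locale von_neumann_regular_ring = ring +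
  assumes ex_inner_inverse: "a \<in> carrier R \<Longrightarrow> \<exists>x. x \<in> inner_inverses R a"

end

theory Submission
  imports Defs
begin

text \<open>Let \<open>x\<close> be an inner inverse of \<open>a\<close>. Since \<open>a (1 - x a) = 0 = (1 - a x) a\<close>, adding any element of
  the right ideal \<open>(1 - x a) R\<close> or of the left ideal \<open>R (1 - a x)\<close> to \<open>x\<close> gives another inner inverse
  of \<open>a\<close>. If all of these are inner inverses of \<open>b\<close> too, then \<open>b\<close> cannot see the perturbation:
  \<open>b (1 - x a) R b = 0\<close> and \<open>b R (1 - a x) b = 0\<close>. A regular ring has no nonzero nilpotent one-sided
  ideals, so already \<open>b (1 - x a) = 0\<close> and \<open>(1 - a x) b = 0\<close>. Hence an inclusion
  \<open>I(a) \<subseteq> I(b)\<close> forces \<open>b = b x a = a x b\<close>. Under equality the roles of \<open>a\<close> and \<open>b\<close> may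
  be exchanged, so that \<open>a = a x b = b\<close>.\<close>

lemma (in abelian_group) eq_if_minus_eq_zero:
  assumes "u \<in> carrier G" "v \<in> carrier G" "u \<ominus> v = \<zero>"
  shows "u = v"
  using assms by (metis a_minus_def a_inv_closed minus_equality minus_minus)

lemma (in ring) inner_inverse_perturb_right:
  assumes "a \<in> carrier R" "r \<in> carrier R" "x \<in> inner_inverses R a"
  shows "x \<oplus> (\<one> \<ominus> x \<otimes> a) \<otimes> r \<in> inner_inverses R a"
proof -
  have x: "x \<in> carrier R" and axa: "a \<otimes> x \<otimes> a = a"
    using assms(3) by (auto simp: inner_inverses_def)
  have "a \<otimes> (\<one> \<ominus> x \<otimes> a) = a \<ominus> a \<otimes> x \<otimes> a"
    using assms(1) x by (simp add: a_minus_def r_distr r_minus m_assoc)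
  then have "a \<otimes> (\<one> \<ominus> x \<otimes> a) = \<zero>"
    using axa assms(1) by (simp add: a_minus_def r_neg)
  then have "a \<otimes> ((\<one> \<ominus> x \<otimes> a) \<otimes> r) = \<zero>"
    using assms x by (simp flip: m_assoc)
  then show ?thesis
    using assms x axa by (simp add: inner_inverses_def r_distr l_distr)
qed

lemma (in ring) inner_inverse_perturb_left:
  assumes "a \<in> carrier R" "r \<in> carrier R" "x \<in> inner_inverses R a"
  shows "x \<oplus> r \<otimes> (\<one> \<ominus> a \<otimes> x) \<in> inner_inverses R a"
proof -
  have x: "x \<in> carrier R" and axa: "a \<otimes> x \<otimes> a = a"
    using assms(3) by (auto simp: inner_inverses_def)
  have "(\<one> \<ominus> a \<otimes> x) \<otimes> a = \<zero>"
    using assms(1) x axa by (simp add: a_minus_def l_distr l_minus r_neg)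
  then have "a \<otimes> (r \<otimes> (\<one> \<ominus> a \<otimes> x)) \<otimes> a = \<zero>"
    using assms x by (simp add: m_assoc)
  then show ?thesis
    using assms x axa by (simp add: inner_inverses_def r_distr l_distr)
qed

lemma (in ring) inner_inverse_difference:
  assumes "b \<in> carrier R" "t \<in> carrier R"
    and "x \<in> inner_inverses R b" "x \<oplus> t \<in> inner_inverses R b"
  shows "b \<otimes> t \<otimes> b = \<zero>"
proof -
  have x: "x \<in> carrier R" and bxb: "b \<otimes> x \<otimes> b = b"
    using assms(3) by (auto simp: inner_inverses_def)
  have "b \<oplus> b \<otimes> t \<otimes> b = b \<oplus> \<zero>"
    using assms x bxb by (simp add: inner_inverses_def r_distr l_distr)
  then show ?thesis
    using assms(1,2) by (simp del: r_zero)
qed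

text \<open>The next two lemmas are the semiprimeness of a regular ring: the product \<open>c = b e\<close> satisfies
  \<open>c R c = 0\<close>, while \<open>c\<close> lies in \<open>c R c\<close>; similarly for \<open>e b\<close>.\<close>

lemma (in von_neumann_regular_ring) mult_eq_zero_if_right_sandwich_zero:
  assumes "b \<in> carrier R" "e \<in> carrier R"
    and zero: "\<And>r. r \<in> carrier R \<Longrightarrow> b \<otimes> (e \<otimes> r) \<otimes> b = \<zero>"
  shows "b \<otimes> e = \<zero>"
proof -
  obtain y where y: "y \<in> carrier R" and c: "b \<otimes> e \<otimes> y \<otimes> (b \<otimes> e) = b \<otimes> e"
    using ex_inner_inverse[of "b \<otimes> e"] assms(1,2) by (auto simp: inner_inverses_def)
  have "b \<otimes> e = (b \<otimes> (e \<otimes> y) \<otimes> b) \<otimes> e"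
    using c assms(1,2) y by (simp add: m_assoc)
  then show ?thesis
    using zero[OF y] assms(2) by simp
qed

lemma (in von_neumann_regular_ring) mult_eq_zero_if_left_sandwich_zero:
  assumes "b \<in> carrier R" "e \<in> carrier R"
    and zero: "\<And>r. r \<in> carrier R \<Longrightarrow> b \<otimes> (r \<otimes> e) \<otimes> b = \<zero>"
  shows "e \<otimes> b = \<zero>"
proof -
  obtain y where y: "y \<in> carrier R" and c: "e \<otimes> b \<otimes> y \<otimes> (e \<otimes> b) = e \<otimes> b"
    using ex_inner_inverse[of "e \<otimes> b"] assms(1,2) by (auto simp: inner_inverses_def)
  have "e \<otimes> b = e \<otimes> (b \<otimes> (y \<otimes> e) \<otimes> b)"
    using c assms(1,2) y by (simp add: m_assoc)
  then show ?thesis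
    using zero[OF y] assms(2) by simp
qed

text \<open>Since also \<open>b x b = b\<close>, these equations say that \<open>b\<close> lies below \<open>a\<close> in the minus partial
  order, which is why the inclusion in both directions leaves only equality.\<close>

lemma (in von_neumann_regular_ring) inner_inverses_subset_imp:
  assumes a: "a \<in> carrier R" and b: "b \<in> carrier R"
    and sub: "inner_inverses R a \<subseteq> inner_inverses R b"
    and xa: "x \<in> inner_inverses R a"
  shows "b \<otimes> x \<otimes> a = b" and "a \<otimes> x \<otimes> b = b"
proof -
  have x: "x \<in> carrier R" and xb: "x \<in> inner_inverses R b"
    using xa sub by (auto simp: inner_inverses_def)
  have "b \<otimes> ((\<one> \<ominus> x \<otimes> a) \<otimes> r) \<otimes> b = \<zero>" if "r \<in> carrier R" for r
    using inner_inverse_difference[OF b _ xb] inner_inverse_perturb_right[OF a that xa] sub a x that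
    by auto
  then have "b \<otimes> (\<one> \<ominus> x \<otimes> a) = \<zero>"
    by (rule mult_eq_zero_if_right_sandwich_zero[rotated 2]) (use a b x in simp_all)
  then have "b \<ominus> b \<otimes> x \<otimes> a = \<zero>"
    using a b x by (simp add: a_minus_def r_distr r_minus m_assoc)
  then show "b \<otimes> x \<otimes> a = b"
    using a b x by (metis eq_if_minus_eq_zero m_closed)
  have "b \<otimes> (r \<otimes> (\<one> \<ominus> a \<otimes> x)) \<otimes> b = \<zero>" if "r \<in> carrier R" for r
    using inner_inverse_difference[OF b _ xb] inner_inverse_perturb_left[OF a that xa] sub a x that
    by auto
  then have "(\<one> \<ominus> a \<otimes> x) \<otimes> b = \<zero>"
    by (rule mult_eq_zero_if_left_sandwich_zero[rotated 2]) (use a b x in simp_all)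
  then have "b \<ominus> a \<otimes> x \<otimes> b = \<zero>"
    using a b x by (simp add: a_minus_def l_distr l_minus)
  then show "a \<otimes> x \<otimes> b = b"
    using a b x by (metis eq_if_minus_eq_zero m_closed)
qed

theorem corollary8:
  fixes R :: "('a, 'm) ring_scheme" and a b :: 'a
  assumes "von_neumann_regular_ring R"
    and "a \<in> carrier R" and "b \<in> carrier R"
  shows "inner_inverses R a = inner_inverses R b \<longleftrightarrow> a = b"
proof
  interpret von_neumann_regular_ring R by fact
  assume eq: "inner_inverses R a = inner_inverses R b"
  obtain x where xa: "x \<in> inner_inverses R a"
    using ex_inner_inverse assms(2) by blast
  have "a \<otimes>\<^bsub>R\<^esub> x \<otimes>\<^bsub>R\<^esub> b = b"
    using inner_inverses_subset_imp(2)[OF assms(2,3) _ xa] eq by simp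
  moreover have "a \<otimes>\<^bsub>R\<^esub> x \<otimes>\<^bsub>R\<^esub> b = a"
    using inner_inverses_subset_imp(1)[OF assms(3,2)] xa eq by simp
  ultimately show "a = b" by simp
qed simp

end
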